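(* Let $S$ be a finite non-empty set and $p:2^S\to\mathbb{Z}\cup\{-\infty\}$ a supermodular function with $p(\emptyset)=0$ and $p(S)$ finite; let $B=\{x\in\mathbb{R}^S:\widetilde x(S)=p(S),\ \widetilde x(Z)\ge p(Z)\ \forall Z\subseteq S\}$, and let $\beta_1$ be the smallest integer for which $B\cap\mathbb{Z}^S$ has an element all of whose components are at most $\beta_1$. Define $h_1(X)=p(X)-(\beta_1-1)|X|$ for $X\subseteq S$. Then the minimum number $r_1$ of components equal to $\beta_1$ in an element of $B\cap\mathbb{Z}^S$ all of whose components are at most $\beta_1$ satisfies $$r_1=\max\{h_1(X):X\subseteq S\}.$$
   Context: $\widetilde x(Z)=\sum_{s\in Z}x(s)$. *)

theory Defs
  imports "HOL-Library.Extended_Real" "HOL-Library.FuncSet"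
begin

text \<open>
  Set functions with values in \<open>\<int> \<union> {-\<infinity>}\<close> are functions into \<^typ>\<open>ereal\<close>, constrained only on the
  subsets of the ground set. Since \<open>\<infinity>\<close> is excluded, no sum of the form \<open>\<infinity> + -\<infinity>\<close> occurs.
\<close>

definition int_or_minf_valued :: "'s set \<Rightarrow> ('s set \<Rightarrow> ereal) \<Rightarrow> bool" where
  "int_or_minf_valued S p \<longleftrightarrow>
     (\<forall>X \<subseteq> S. p X = -\<infinity> \<or> (\<exists>k::int. p X = ereal (real_of_int k)))"

definition supermodular :: "'s set \<Rightarrow> ('s set \<Rightarrow> ereal) \<Rightarrow> bool" where
  "supermodular S p \<longleftrightarrow>
     (\<forall>X \<subseteq> S. \<forall>Y \<subseteq> S. p X + p Y \<le> p (X \<inter> Y) + p (X \<union> Y))"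

text \<open>
  The space \<open>\<real>\<^sup>S\<close> is \<^term>\<open>S \<rightarrow>\<^sub>E (UNIV :: real set)\<close>: extensionality gives each vector exactly one
  representative.
\<close>

definition base_polyhedron :: "'s set \<Rightarrow> ('s set \<Rightarrow> ereal) \<Rightarrow> ('s \<Rightarrow> real) set" where
  "base_polyhedron S p =
     {x \<in> S \<rightarrow>\<^sub>E UNIV. ereal (\<Sum>s\<in>S. x s) = p S \<and>
                       (\<forall>Z \<subseteq> S. p Z \<le> ereal (\<Sum>s\<in>Z. x s))}"

definition bounded_int_bases ::
    "'s set \<Rightarrow> ('s set \<Rightarrow> ereal) \<Rightarrow> int \<Rightarrow> ('s \<Rightarrow> real) set" where
  "bounded_int_bases S p b =
     {x \<in> base_polyhedron S p \<inter> (S \<rightarrow>\<^sub>E \<int>). \<forall>s\<in>S. x s \<le> real_of_int b}"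

definition beta1 :: "'s set \<Rightarrow> ('s set \<Rightarrow> ereal) \<Rightarrow> int" where
  "beta1 S p = (LEAST b. bounded_int_bases S p b \<noteq> {})"

definition r1 :: "'s set \<Rightarrow> ('s set \<Rightarrow> ereal) \<Rightarrow> nat" where
  "r1 S p = Min ((\<lambda>x. card {s \<in> S. x s = real_of_int (beta1 S p)})
                   ` bounded_int_bases S p (beta1 S p))"

definition h1 :: "'s set \<Rightarrow> ('s set \<Rightarrow> ereal) \<Rightarrow> 's set \<Rightarrow> ereal" where
  "h1 S p X = p X - ereal (real_of_int (beta1 S p - 1) * real (card X))"

end

theory Submission
  imports Defs
begin

text \<open>
  If an integral vector \<open>u\<close> dominates \<open>p\<close> on all subsets, supermodularity makes the sets on which
  \<open>u\<close> is tight closed under union, and a component outside all tight sets can be lowered by one.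
  Lowering components as long as possible makes \<open>S\<close> itself tight, so \<open>u\<close> lies above an integral
  element of the base polyhedron. The same descent, applied to the vectors \<open>\<beta>\<^sub>1 - 1 + \<chi>\<^sub>R\<close> with
  \<open>R \<subseteq> S\<close>, ends with an \<open>R\<close> that is contained in a tight set \<open>T\<close>; then \<open>h\<^sub>1(T) = |R|\<close>, and below
  \<open>\<beta>\<^sub>1 - 1 + \<chi>\<^sub>R\<close> there is a base with at most \<open>|R|\<close> components equal to \<open>\<beta>\<^sub>1\<close>.
\<close>

section \<open>Dominating vectors and their tight sets\<close>

definition dominates :: "'s set \<Rightarrow> ('s set \<Rightarrow> ereal) \<Rightarrow> ('s \<Rightarrow> int) \<Rightarrow> bool" where
  "dominates S p u \<longleftrightarrow> (\<forall>X \<subseteq> S. p X \<le> ereal (real_of_int (sum u X)))"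

definition tight :: "('s set \<Rightarrow> ereal) \<Rightarrow> ('s \<Rightarrow> int) \<Rightarrow> 's set \<Rightarrow> bool" where
  "tight p u X \<longleftrightarrow> p X = ereal (real_of_int (sum u X))"

text \<open>Since \<open>sum u\<close> is modular, supermodularity and domination on
  \<open>X \<inter> Y\<close> and \<open>X \<union> Y\<close> squeeze both of these sets to
  equality. Their \<open>p\<close>-values cannot be infinite: \<open>p X + p Y\<close> is finite,
  and domination bounds them above.\<close>

lemma tight_Un:
  assumes "finite S" "supermodular S p" "dominates S p u"
    and "X \<subseteq> S" "Y \<subseteq> S" "tight p u X" "tight p u Y"
  shows "tight p u (X \<union> Y)"
proof -
  have fin: "finite X" "finite Y"
    using assms by (auto intro: finite_subset)
  have "sum u (X \<union> Y) + sum u (X \<inter> Y) = sum u X + sum u Y"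
    using fin by (rule sum.union_inter)
  hence sums: "real_of_int (sum u (X \<union> Y)) + real_of_int (sum u (X \<inter> Y))
      = real_of_int (sum u X) + real_of_int (sum u Y)"
    by (simp only: of_int_add[symmetric])
  have "p X + p Y \<le> p (X \<inter> Y) + p (X \<union> Y)"
    using assms by (auto simp: supermodular_def)
  moreover have "p X = ereal (real_of_int (sum u X))" "p Y = ereal (real_of_int (sum u Y))"
    using assms by (auto simp: tight_def)
  moreover have "p (X \<inter> Y) \<le> ereal (real_of_int (sum u (X \<inter> Y)))"
    and "p (X \<union> Y) \<le> ereal (real_of_int (sum u (X \<union> Y)))"
    using assms by (auto simp: dominates_def le_infI1)
  ultimately show ?thesis
    using sums unfolding tight_def
    by (cases "p (X \<inter> Y)"; cases "p (X \<union> Y)") auto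
qed

lemma tight_superset:
  assumes "finite S" "supermodular S p" "dominates S p u" "p {} = 0"
    and "A \<subseteq> S" and cover: "\<And>s. s \<in> A \<Longrightarrow> \<exists>X \<subseteq> S. s \<in> X \<and> tight p u X"
  obtains T where "A \<subseteq> T" "T \<subseteq> S" "tight p u T"
proof -
  have "finite A"
    using assms(1,5) by (rule rev_finite_subset)
  hence "\<exists>T. A \<subseteq> T \<and> T \<subseteq> S \<and> tight p u T"
    using cover
  proof (induction A)
    case empty
    show ?case
      \<comment> \<open>The normalisation of \<open>p\<close> makes the empty set tight, which
        starts the union.\<close>
      using \<open>p {} = 0\<close> by (intro exI[of _ "{}"]) (simp add: tight_def)
  next
    case (insert a A)
    then obtain T where T: "A \<subseteq> T" "T \<subseteq> S" "tight p u T"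
      by auto
    obtain X where X: "X \<subseteq> S" "a \<in> X" "tight p u X"
      using insert.prems by blast
    have "tight p u (X \<union> T)"
      using tight_Un assms(1-3) X T by blast
    thus ?case
      using X T by (intro exI[of _ "X \<union> T"]) auto
  qed
  thus ?thesis
    using that by blast
qed

section \<open>Lowering components down to an integral base\<close>

text \<open>Only sets containing \<open>s\<close> lose anything, and they lose exactly one. None of
  these is tight, so by integrality each has slack at least one.\<close>

lemma dominates_decrease:
  assumes "finite S" "int_or_minf_valued S p" "dominates S p u"
    and "\<And>X. X \<subseteq> S \<Longrightarrow> s \<in> X \<Longrightarrow> \<not> tight p u X"
  shows "dominates S p (u(s := u s - 1))"
  unfolding dominates_def
proof (intro allI impI)
  fix X assume X: "X \<subseteq> S"
  have fin: "finite X"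
    using assms(1) X by (rule rev_finite_subset)
  have le: "p X \<le> ereal (real_of_int (sum u X))"
    using assms(3) X by (simp add: dominates_def)
  show "p X \<le> ereal (real_of_int (sum (u(s := u s - 1)) X))"
  proof (cases "s \<in> X")
    case False
    hence "sum (u(s := u s - 1)) X = sum u X"
      by (intro sum.cong) auto
    thus ?thesis using le by simp
  next
    case True
    have "sum (u(s := u s - 1)) (X - {s}) = sum u (X - {s})"
      by (intro sum.cong) auto
    hence sums: "sum (u(s := u s - 1)) X = sum u X - 1"
      using sum.remove[OF fin True, of u] sum.remove[OF fin True, of "u(s := u s - 1)"] by simp
    have neq: "p X \<noteq> ereal (real_of_int (sum u X))"
      using assms(4)[OF X True] unfolding tight_def .
    consider "p X = -\<infinity>" | k where "p X = ereal (real_of_int k)"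
      using assms(2) X by (auto simp: int_or_minf_valued_def)
    thus ?thesis
    proof cases
      case (2 k)
      have "k \<le> sum u X"
        using le unfolding 2 ereal_less_eq of_int_le_iff .
      moreover have "k \<noteq> sum u X"
        using neq 2 by blast
      ultimately show ?thesis
        unfolding sums 2 ereal_less_eq of_int_le_iff by linarith
    qed simp
  qed
qed

lemma dominates_imp_int_base:
  assumes "finite S" "int_or_minf_valued S p" "supermodular S p" "p {} = 0"
    and "p S = ereal (real_of_int k)" and "dominates S p u"
  obtains v where "dominates S p v" "tight p v S" "\<And>s. v s \<le> u s"
proof -
  have "\<exists>v. dominates S p v \<and> tight p v S \<and> (\<forall>s. v s \<le> u s)"
    using assms(6)
  proof (induction "nat (sum u S - k)" arbitrary: u rule: less_induct)
    case less
    show ?case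
    proof (cases "tight p u S")
      case True
      thus ?thesis using less.prems by auto
    next
      case False
      \<comment> \<open>If every element lay in a tight set, the union of those sets would make
        \<open>S\<close> tight.\<close>
      have "\<exists>s\<in>S. \<forall>X \<subseteq> S. s \<in> X \<longrightarrow> \<not> tight p u X"
      proof (rule ccontr)
        assume "\<not> ?thesis"
        hence "\<exists>X \<subseteq> S. s \<in> X \<and> tight p u X" if "s \<in> S" for s
          using that by blast
        then obtain T where "S \<subseteq> T" "T \<subseteq> S" "tight p u T"
          by (rule tight_superset[OF assms(1,3) less.prems assms(4) subset_refl])
        thus False using False by simp
      qed
      then obtain s where s: "s \<in> S" "\<And>X. X \<subseteq> S \<Longrightarrow> s \<in> X \<Longrightarrow> \<not> tight p u X"
        by blast
      let ?u = "u(s := u s - 1)"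
      have dom: "dominates S p ?u"
        using assms(1,2) less.prems s(2) by (rule dominates_decrease)
      have "sum ?u (S - {s}) = sum u (S - {s})"
        by (intro sum.cong) auto
      hence "sum ?u S = sum u S - 1"
        using sum.remove[OF assms(1) s(1), of u] sum.remove[OF assms(1) s(1), of ?u] by simp
      \<comment> \<open>The lowered vector still dominates \<open>p\<close> on \<open>S\<close>, so
        \<open>nat\<close> truncates nothing and the measure strictly drops.\<close>
      moreover have "p S \<le> ereal (real_of_int (sum ?u S))"
        using dom unfolding dominates_def by blast
      hence "k \<le> sum ?u S"
        unfolding assms(5) ereal_less_eq of_int_le_iff .
      ultimately have "nat (sum ?u S - k) < nat (sum u S - k)"
        by linarith
      from less.hyps[OF this dom] obtain v
        where v: "dominates S p v" "tight p v S" "\<forall>t. v t \<le> ?u t"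
        by blast
      have "v t \<le> u t" for t
        using v(3)[rule_format, of t] by (simp split: if_splits)
      thus ?thesis using v(1,2) by blast
    qed
  qed
  thus ?thesis
    using that by blast
qed

text \<open>Passes from integer functions on the whole type to extensional real vectors. It is
  applied to a constant \<open>u\<close> for the existence of \<beta>1, and to an indicator shift
  for the minimum.\<close>

lemma bounded_int_base_below:
  assumes "finite S" "int_or_minf_valued S p" "supermodular S p" "p {} = 0" "p S \<noteq> -\<infinity>"
    and "dominates S p u" "\<And>s. s \<in> S \<Longrightarrow> u s \<le> b"
  obtains x where "x \<in> bounded_int_bases S p b" "\<And>s. s \<in> S \<Longrightarrow> x s \<le> real_of_int (u s)"
proof -
  obtain k where k: "p S = ereal (real_of_int k)"
    using assms(2,5) by (auto simp: int_or_minf_valued_def)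
  obtain v where v: "dominates S p v" "tight p v S" "\<And>s. v s \<le> u s"
    using dominates_imp_int_base[OF assms(1-4) k assms(6)] by blast
  define x where "x = (\<lambda>s\<in>S. real_of_int (v s))"
  have sums: "(\<Sum>s\<in>Z. x s) = real_of_int (sum v Z)" if "Z \<subseteq> S" for Z
  proof -
    have "(\<Sum>s\<in>Z. x s) = (\<Sum>s\<in>Z. real_of_int (v s))"
      using that by (intro sum.cong) (auto simp: x_def)
    thus ?thesis by simp
  qed
  have "x \<in> bounded_int_bases S p b"
    unfolding bounded_int_bases_def base_polyhedron_def
  proof (intro CollectI conjI IntI ballI allI impI)
    show "x \<in> S \<rightarrow>\<^sub>E UNIV" "x \<in> S \<rightarrow>\<^sub>E \<int>"
      by (auto simp: x_def)
    show "ereal (\<Sum>s\<in>S. x s) = p S"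
      using v(2) sums[of S] by (simp add: tight_def)
    show "p Z \<le> ereal (\<Sum>s\<in>Z. x s)" if "Z \<subseteq> S" for Z
      using v(1) sums[OF that] that by (simp add: dominates_def)
    show "x s \<le> real_of_int b" if "s \<in> S" for s
      using order_trans[OF v(3) assms(7)[OF that]] that by (simp add: x_def)
  qed
  moreover have "x s \<le> real_of_int (u s)" if "s \<in> S" for s
    using v(3) that by (simp add: x_def)
  ultimately show ?thesis
    using that by blast
qed

text \<open>A converse to the case of constant \<open>u\<close> in
  \<open>bounded_int_base_below\<close>.\<close>

lemma dominates_const:
  assumes "x \<in> bounded_int_bases S p b"
  shows "dominates S p (\<lambda>_. b)"
  unfolding dominates_def
proof (intro allI impI)
  fix X assume X: "X \<subseteq> S"
  have "(\<Sum>s\<in>X. x s) \<le> (\<Sum>s\<in>X. real_of_int b)"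
    using assms X by (intro sum_mono) (auto simp: bounded_int_bases_def)
  moreover have "p X \<le> ereal (\<Sum>s\<in>X. x s)"
    using assms X by (auto simp: bounded_int_bases_def base_polyhedron_def)
  ultimately show "p X \<le> ereal (real_of_int (\<Sum>s\<in>X. b))"
    by (simp add: order_trans)
qed

section \<open>Existence of the least bound \<beta>1\<close>

lemma exists_dominates_const:
  assumes "finite S" "int_or_minf_valued S p" "p {} = 0"
  obtains b where "dominates S p (\<lambda>_. b)"
proof -
  \<comment> \<open>A crude bound: it is non-negative and at least every finite value of
    \<open>p\<close>. Sets of value \<open>-\<infinity>\<close> contribute 0, as
    \<open>real_of_ereal\<close> sends it to 0.\<close>
  define b where "b = (\<Sum>X\<in>Pow S. \<bar>\<lfloor>real_of_ereal (p X)\<rfloor>\<bar>)"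
  have "dominates S p (\<lambda>_. b)"
    unfolding dominates_def
  proof (intro allI impI)
    fix X assume X: "X \<subseteq> S"
    consider "p X = -\<infinity>" | k where "p X = ereal (real_of_int k)"
      using assms(2) X by (auto simp: int_or_minf_valued_def)
    thus "p X \<le> ereal (real_of_int (\<Sum>s\<in>X. b))"
    proof cases
      case 1
      thus ?thesis by simp
    next
      case (2 k)
      show ?thesis
      proof (cases "X = {}")
        case True
        thus ?thesis using assms(3) by simp
      next
        case False
        hence card: "int (card X) \<ge> 1"
          using finite_subset[OF X assms(1)] by (simp add: Suc_leI card_gt_0_iff)
        have "\<bar>\<lfloor>real_of_ereal (p X)\<rfloor>\<bar> \<le> b"
          unfolding b_def using X assms(1) by (intro member_le_sum) auto
        hence "k \<le> b" "0 \<le> b"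
          using 2 by auto
        hence "k \<le> int (card X) * b"
          using mult_right_mono[OF card \<open>0 \<le> b\<close>] by linarith
        thus ?thesis
          unfolding 2 ereal_less_eq of_int_le_iff by simp
      qed
    qed
  qed
  thus ?thesis
    using that by blast
qed

text \<open>The order on \<open>int\<close> is not well-founded, so the lower bound \<open>l\<close>
  is used to shift the search to \<open>nat\<close>.\<close>

lemma int_LeastI_ex_bounded_below:
  fixes P :: "int \<Rightarrow> bool"
  assumes "P b" and "\<And>b. P b \<Longrightarrow> l \<le> b"
  shows "P (LEAST b. P b)"
proof -
  define n where "n = (LEAST n. P (l + int n))"
  have ex: "P (l + int (nat (b - l)))"
    using assms by simp
  have n: "P (l + int n)"
    unfolding n_def using ex by (rule LeastI)
  have "(LEAST b. P b) = l + int n"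
  proof (rule Least_equality)
    show "P (l + int n)" by (rule n)
  next
    fix y assume y: "P y"
    hence "P (l + int (nat (y - l)))"
      using assms(2) by simp
    hence "n \<le> nat (y - l)"
      unfolding n_def by (rule Least_le)
    thus "l + int n \<le> y"
      using assms(2)[OF y] by linarith
  qed
  thus ?thesis using n by simp
qed

lemma bounded_int_bases_beta1_nonempty:
  assumes "finite S" "S \<noteq> {}" "int_or_minf_valued S p" "supermodular S p" "p {} = 0"
    and "p S \<noteq> -\<infinity>"
  shows "bounded_int_bases S p (beta1 S p) \<noteq> {}"
proof -
  obtain k where k: "p S = ereal (real_of_int k)"
    using assms(3,6) by (auto simp: int_or_minf_valued_def)
  obtain b where "dominates S p (\<lambda>_. b)"
    using exists_dominates_const assms by blast
  then obtain x where "x \<in> bounded_int_bases S p b"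
    using bounded_int_base_below[OF assms(1,3-6), of "\<lambda>_. b" b] by blast
  hence "bounded_int_bases S p b \<noteq> {}"
    by blast
  thus ?thesis
    unfolding beta1_def
  \<comment> \<open>For negative \<open>c\<close>, non-emptiness of \<open>S\<close> gives
    \<open>k \<le> int (card S) * c \<le> c\<close>.\<close>
  proof (rule int_LeastI_ex_bounded_below[where l = "- \<bar>k\<bar>"])
    fix c assume "bounded_int_bases S p c \<noteq> {}"
    hence "dominates S p (\<lambda>_. c)"
      using dominates_const by blast
    hence "p S \<le> ereal (real_of_int (\<Sum>s\<in>S. c))"
      by (simp add: dominates_def)
    hence "k \<le> (\<Sum>s\<in>S. c)"
      unfolding k ereal_less_eq of_int_le_iff .
    hence kc: "k \<le> int (card S) * c"
      by simp
    have card: "int (card S) \<ge> 1"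
      using assms(1,2) by (simp add: Suc_leI card_gt_0_iff)
    show "- \<bar>k\<bar> \<le> c"
    proof (cases "c \<ge> 0")
      case False
      hence "int (card S) * c \<le> 1 * c"
        using card by (intro mult_right_mono_neg) auto
      thus ?thesis using kc by linarith
    qed linarith
  qed
qed

section \<open>Comparing \<open>h1\<close> with the number of maximal components\<close>

text \<open>Polymorphic because it is used both for real and for integer sums.\<close>

lemma sum_add_indicator:
  fixes c :: "'a :: comm_semiring_1"
  assumes "finite X"
  shows "(\<Sum>s\<in>X. c + of_bool (s \<in> R)) = of_nat (card X) * c + of_nat (card (X \<inter> R))"
  using assms by (simp add: sum.distrib sum_of_bool_eq Int_def)

text \<open>An integral component below \<beta>1 is at most \<beta>1 - 1. Hence \<open>x\<close>
  lies below \<beta>1 - 1 plus the indicator of \<open>?R\<close>, and summing over \<open>X\<close>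
  gives the bound.\<close>

lemma h1_le_card_eq_beta1:
  assumes "finite S" "x \<in> bounded_int_bases S p (beta1 S p)" "X \<subseteq> S"
  shows "h1 S p X \<le> ereal (real (card {s \<in> S. x s = real_of_int (beta1 S p)}))"
proof -
  let ?b = "beta1 S p"
  let ?R = "{s \<in> S. x s = real_of_int ?b}"
  have fin: "finite X"
    using assms by (auto intro: finite_subset)
  have bound: "x s \<le> real_of_int (?b - 1) + of_bool (s \<in> ?R)" if "s \<in> X" for s
  proof -
    have s: "s \<in> S" "x s \<in> \<int>" "x s \<le> real_of_int ?b"
      using assms that by (auto simp: bounded_int_bases_def)
    then obtain m where "x s = real_of_int m"
      by (auto elim: Ints_cases)
    thus ?thesis using s by auto
  qed
  have "p X \<le> ereal (\<Sum>s\<in>X. x s)"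
    using assms by (auto simp: bounded_int_bases_def base_polyhedron_def)
  also have "(\<Sum>s\<in>X. x s) \<le> (\<Sum>s\<in>X. real_of_int (?b - 1) + of_bool (s \<in> ?R))"
    using bound by (rule sum_mono)
  also have "\<dots> = real (card X) * real_of_int (?b - 1) + real (card (X \<inter> ?R))"
    using sum_add_indicator[OF fin] .
  also have "real (card (X \<inter> ?R)) \<le> real (card ?R)"
    using assms(1) by (intro of_nat_mono card_mono) auto
  finally have "p X \<le> ereal (real (card X) * real_of_int (?b - 1) + real (card ?R))"
    by simp
  thus ?thesis
    unfolding h1_def by (cases "p X") (auto simp: mult.commute)
qed

lemma dominates_indicator_minimal:
  assumes "finite S" "int_or_minf_valued S p" "supermodular S p" "p {} = 0"
    and "dominates S p (\<lambda>_. b)"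
  obtains R T where "R \<subseteq> T" "T \<subseteq> S"
    "dominates S p (\<lambda>s. b - 1 + of_bool (s \<in> R))" "tight p (\<lambda>s. b - 1 + of_bool (s \<in> R)) T"
proof -
  define u where "u R = (\<lambda>s. b - 1 + of_bool (s \<in> R))" for R :: "'a set"
  have "dominates S p (u S)"
    unfolding dominates_def
  proof (intro allI impI)
    fix X assume X: "X \<subseteq> S"
    hence "sum (u S) X = (\<Sum>s\<in>X. b)"
      by (intro sum.cong) (auto simp: u_def)
    thus "p X \<le> ereal (real_of_int (sum (u S) X))"
      using assms(5) X by (simp add: dominates_def)
  qed
  hence "\<exists>R. R \<subseteq> S \<and> dominates S p (u R)"
    by blast
  \<comment> \<open>A choice of least cardinality replaces the descent: deleting \<open>s\<close>
    from \<open>R\<close> is the same as lowering component \<open>s\<close> by one.\<close>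
  then obtain R where R: "R \<subseteq> S" "dominates S p (u R)"
    and min: "\<And>Q. Q \<subseteq> S \<Longrightarrow> dominates S p (u Q) \<Longrightarrow> card R \<le> card Q"
    using ex_has_least_nat[of "\<lambda>R. R \<subseteq> S \<and> dominates S p (u R)" _ card] by metis
  have "\<exists>X \<subseteq> S. s \<in> X \<and> tight p (u R) X" if s: "s \<in> R" for s
  proof (rule ccontr)
    assume "\<not> ?thesis"
    hence "dominates S p ((u R)(s := u R s - 1))"
      using dominates_decrease[OF assms(1,2) R(2)] by blast
    also have "(u R)(s := u R s - 1) = u (R - {s})"
      using s by (auto simp: u_def)
    finally have "card R \<le> card (R - {s})"
      using R(1) min by blast
    moreover have "card (R - {s}) < card R"
      using s rev_finite_subset[OF assms(1) R(1)] by (intro card_Diff1_less)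
    ultimately show False by simp
  qed
  then obtain T where "R \<subseteq> T" "T \<subseteq> S" "tight p (u R) T"
    using tight_superset[OF assms(1,3) R(2) assms(4) R(1)] by blast
  thus ?thesis
    using that R(2) unfolding u_def by blast
qed

theorem theorem4p3:
  fixes S :: "'s set" and p :: "'s set \<Rightarrow> ereal"
  assumes "finite S" and "S \<noteq> {}"
    and "int_or_minf_valued S p"
    and "supermodular S p"
    and "p {} = 0"
    and "p S \<noteq> -\<infinity>"
  shows "ereal (real (r1 S p)) = Max (h1 S p ` Pow S)"
proof -
  define b where "b = beta1 S p"
  define N where "N = (\<lambda>x. card {s \<in> S. x s = real_of_int b})"
  let ?B = "bounded_int_bases S p b"
  have r1: "r1 S p = Min (N ` ?B)"
    by (simp only: r1_def N_def b_def)
  have ne: "?B \<noteq> {}"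
    unfolding b_def using assms by (rule bounded_int_bases_beta1_nonempty)
  \<comment> \<open>\<open>Min\<close> needs a finite set; bounding the counts suffices.\<close>
  have "N x \<le> card S" for x
    unfolding N_def using assms(1) by (rule card_mono) blast
  hence fin: "finite (N ` ?B)"
    by (meson finite_atMost finite_subset atMost_iff image_subsetI)
  have le: "h1 S p X \<le> ereal (real (N x))" if "x \<in> ?B" "X \<subseteq> S" for x X
    using h1_le_card_eq_beta1[OF assms(1) that(1)[unfolded b_def] that(2)]
    unfolding N_def b_def .
  obtain x0 where "x0 \<in> ?B"
    using ne by blast
  hence "dominates S p (\<lambda>_. b)"
    by (rule dominates_const)
  then obtain R T where RT: "R \<subseteq> T" "T \<subseteq> S"
    and dom: "dominates S p (\<lambda>s. b - 1 + of_bool (s \<in> R))"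
    and tight: "tight p (\<lambda>s. b - 1 + of_bool (s \<in> R)) T"
    by (rule dominates_indicator_minimal[OF assms(1,3-5)])
  have finT: "finite T"
    using assms(1) RT(2) by (rule rev_finite_subset)
  hence finR: "finite R"
    using RT(1) by (rule rev_finite_subset)
  have "p T = ereal (real_of_int (int (card T) * (b - 1) + int (card (T \<inter> R))))"
    using tight unfolding tight_def sum_add_indicator[OF finT] .
  moreover have "T \<inter> R = R"
    using RT by blast
  \<comment> \<open>The term \<open>(b - 1) * card T\<close> cancels, and
    \<open>R \<subseteq> T\<close> leaves all of \<open>card R\<close>.\<close>
  ultimately have hT: "h1 S p T = ereal (real (card R))"
    by (simp add: h1_def b_def algebra_simps)
  have "b - 1 + of_bool (s \<in> R) \<le> b" for s
    by simp
  then obtain x where x: "x \<in> ?B"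
    "\<And>s. s \<in> S \<Longrightarrow> x s \<le> real_of_int (b - 1 + of_bool (s \<in> R))"
    using bounded_int_base_below[OF assms(1,3-6) dom, of b] by blast
  \<comment> \<open>Outside \<open>R\<close> the components of \<open>x\<close> are at most
    \<open>b - 1\<close>.\<close>
  have "{s \<in> S. x s = real_of_int b} \<subseteq> R"
  proof
    fix s assume "s \<in> {s \<in> S. x s = real_of_int b}"
    thus "s \<in> R"
      using x(2)[of s] by (cases "s \<in> R") auto
  qed
  hence N_le: "N x \<le> card R"
    unfolding N_def using finR by (intro card_mono)
  \<comment> \<open>The general inequality at \<open>T\<close> bounds every count below by
    \<open>card R\<close>, so \<open>x\<close> attains the minimum and \<open>T\<close> the
    maximum.\<close>
  have N_ge: "card R \<le> N y" if "y \<in> ?B" for y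
    using le[OF that RT(2)] hT by simp
  have N: "card R = N x"
    using N_ge[OF x(1)] N_le by simp
  have "card R \<in> N ` ?B"
    using N x(1) by (rule image_eqI)
  hence "Min (N ` ?B) = card R"
    using N_ge fin by (intro Min_eqI) auto
  moreover have "Max (h1 S p ` Pow S) = ereal (real (card R))"
  proof (rule Max_eqI)
    show "finite (h1 S p ` Pow S)"
      using assms(1) by simp
    show "ereal (real (card R)) \<in> h1 S p ` Pow S"
      using hT RT(2) by (intro image_eqI[of _ _ T]) auto
    show "y \<le> ereal (real (card R))" if "y \<in> h1 S p ` Pow S" for y
      using that le[OF x(1)] N by auto
  qed
  ultimately show ?thesis
    using r1 by simp
qed

end
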